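(* For every pair of integers $1\le q\le m$, there exists a rational simplicial cone $K_{m,q}\subseteq\mathbb R_+^{m+1}$ such that $P_{m,q}=K_{m,q}\cap[0,1]^{m+1}$ is a simplex with $m$ nonzero vertices and universal stabilization depth $s(P_{m,q})$ exactly $q$.
   Context: A rational simplicial cone is a cone generated by finitely many linearly independent rational vectors. $P=\operatorname{conv}\{0,r^1,\dots,r^m\}$ is a simplex if $r^1,\dots,r^m$ are linearly independent. Let $E$ be the index set of coordinates ($|E|=m+1$), $K\subseteq\mathbb R_+^E$ a polyhedral cone, $P=K\cap[0,1]^E$. For $y\in\mathbb R_+^E$, $\operatorname{supp}(y)=\{e\in E:y_e>0\}$. For $c\in\mathbb R^E$ let $\alpha(c)=\max\{c^\top y:y\in P\}$. For $c$ with $\alpha(c)>0$ and an integer $\ell\ge1$, $\mathcal B_\ell(c)$ is the family of sets $J\subseteq E$ such that for all $z^1,\dots,z^\ell\in P$: $\left(\bigcap_{i=1}^\ell\operatorname{supp}(z^i)\right)\cap J=\emptyset$ implies $\sum_{i=1}^\ell c^\top z^i\le\alpha(c)(\ell-1)$. $\mathcal B_\infty(c)=\bigcap_{\ell\ge1}\mathcal B_\ell(c)$. The universal stabilization depth of $P$ is $$s(P)=\min\{q\ge1:\ \mathcal B_q(c)=\mathcal B_\infty(c)\text{ for every }c\text{ with }\alpha(c)>0\}.$$ *)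

theory Defs
  imports "HOL-Analysis.Analysis" "HOL-Library.Extended_Nat"
begin

definition rational_simplicial_cone :: "(real ^ 'n) set \<Rightarrow> bool" where
  "rational_simplicial_cone K \<longleftrightarrow>
     (\<exists>R. finite R \<and> independent R \<and> (\<forall>r\<in>R. \<forall>e. r $ e \<in> \<rat>) \<and> K = convex_cone hull R)"

text \<open>The convex hull of the origin and \<open>m\<close> linearly independent vectors (its nonzero vertices).\<close>

definition simplex_at_origin :: "nat \<Rightarrow> (real ^ 'n) set \<Rightarrow> bool" where
  "simplex_at_origin m P \<longleftrightarrow>
     (\<exists>V. finite V \<and> independent V \<and> card V = m \<and> P = convex hull (insert 0 V))"

definition supp :: "real ^ 'n \<Rightarrow> 'n set" where
  "supp y = {e. y $ e > 0}"

text \<open>For nonempty compact \<open>P\<close> the supremum is a maximum, see \<open>alpha_attained\<close> below.\<close>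

definition alpha :: "(real ^ 'n) set \<Rightarrow> real ^ 'n \<Rightarrow> real" where
  "alpha P c = (SUP y\<in>P. c \<bullet> y)"

definition blocking_family :: "(real ^ 'n) set \<Rightarrow> real ^ 'n \<Rightarrow> nat \<Rightarrow> 'n set set" where
  "blocking_family P c l =
     {J. \<forall>z :: nat \<Rightarrow> real ^ 'n. (\<forall>i\<in>{1..l}. z i \<in> P) \<longrightarrow>
           (\<Inter>i\<in>{1..l}. supp (z i)) \<inter> J = {} \<longrightarrow>
           (\<Sum>i=1..l. c \<bullet> z i) \<le> alpha P c * (real l - 1)}"

definition blocking_family_inf :: "(real ^ 'n) set \<Rightarrow> real ^ 'n \<Rightarrow> 'n set set" where
  "blocking_family_inf P c = (\<Inter>l\<in>{1..}. blocking_family P c l)"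

text \<open>The infimum in \<^typ>\<open>enat\<close> of a nonempty set is its minimum; the depth is \<open>\<infinity>\<close>
  if no \<open>q\<close> qualifies.\<close>

definition stabilization_depth :: "(real ^ 'n) set \<Rightarrow> enat" where
  "stabilization_depth P =
     Inf {enat q | q. q \<ge> 1 \<and>
       (\<forall>c. alpha P c > 0 \<longrightarrow> blocking_family P c q = blocking_family_inf P c)}"

lemma alpha_attained:
  fixes P :: "(real ^ 'n) set"
  assumes "compact P" "P \<noteq> {}"
  shows "\<exists>y\<in>P. c \<bullet> y = alpha P c \<and> (\<forall>x\<in>P. c \<bullet> x \<le> c \<bullet> y)"
proof -
  have "continuous_on P (\<lambda>y. c \<bullet> y)"
    by (intro continuous_intros)
  then obtain y where y: "y \<in> P" "\<forall>x\<in>P. c \<bullet> x \<le> c \<bullet> y"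
    using continuous_attains_sup[OF assms] by blast
  then have "alpha P c = c \<bullet> y"
    unfolding alpha_def by (intro cSup_eq_maximum) auto
  with y show ?thesis by auto
qed

end

theory Submission
  imports Defs
begin

text \<open>
  Fix an objective \<open>c\<close> with maximum \<open>\<alpha> > 0\<close> over a polytope \<open>P\<close> spanned by the origin and a finite
  set \<open>R\<close> of nonnegative vectors, and call \<open>\<alpha> - c \<bullet> z\<close> the loss of \<open>z\<close>. Points \<open>z\<^sub>1, \<dots>, z\<^sub>l\<close> witness
  that \<open>J\<close> is not in \<open>blocking_family P c l\<close> iff no coordinate in \<open>J\<close> lies in all their supports and
  their total loss is less than \<open>\<alpha>\<close>. Each loss is nonnegative, so every single loss is below \<open>\<alpha>\<close>
  and every \<open>z\<^sub>i\<close> has a positive value. Hence \<open>z\<^sub>i\<close> may be replaced by the best of the generators that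
  occur in it, which has no larger support and no larger loss; conversely a shorter list
  is padded for free with a maximiser of \<open>c\<close>. So \<open>J\<close> fails at level \<open>l\<close> iff it is covered by the
  complements of the supports of at most \<open>l\<close> generators whose total loss is less than \<open>\<alpha>\<close>
  (\<open>not_in_blocking_family_iff\<close>). The depth is thereby governed by a covering problem: it is at most
  \<open>q\<close> as soon as every cover by complements of supports contains a cover with at most \<open>q\<close> members.

  It remains to choose supports for which the covering problem has the answer \<open>q\<close>. Fix one
  coordinate \<open>p\<close> and a set \<open>A\<close> of \<open>q\<close> other coordinates. For each coordinate \<open>e \<noteq> p\<close> the generator
  \<open>ray A e\<close> is the all-ones vector with entry \<open>e\<close> lowered to \<open>0\<close> if \<open>e \<in> A\<close> and to \<open>1/2\<close> otherwise.
  The complements of the supports are the singletons \<open>{a}\<close> for \<open>a \<in> A\<close>, and empty sets, so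
  the only coverable \<open>J\<close> are the subsets of \<open>A\<close>, and \<open>J\<close> has exactly one minimal cover, of size
  \<open>card J\<close>. For the objective \<open>x \<mapsto> x $ p\<close> all generators have loss \<open>0\<close>, so \<open>J = A\<close> shows that
  fewer than \<open>q\<close> points are not enough. All generators have entry \<open>1\<close> at \<open>p\<close> and
  entries at most \<open>1\<close> elsewhere, so the unit box cuts the cone they span in the simplex
  with these generators as its nonzero vertices.
\<close>

section \<open>Cones cut by the unit box\<close>

lemma convex_cone_hull_finite:
  fixes S :: "'a::real_vector set"
  assumes "finite S"
  shows "convex_cone hull S = {\<Sum>x\<in>S. u x *\<^sub>R x | u. \<forall>x\<in>S. 0 \<le> u x}" (is "_ = ?T")
proof (rule hull_unique)
  show "S \<subseteq> ?T"
  proof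
    fix y assume y: "y \<in> S"
    have "(\<Sum>x\<in>S. (if x = y then 1 else 0) *\<^sub>R x) = (\<Sum>x\<in>S. if x = y then y else 0)"
      by (intro sum.cong) auto
    also have "\<dots> = y"
      using assms y by simp
    finally show "y \<in> ?T"
      by (intro CollectI exI[of _ "\<lambda>x. if x = y then 1 else 0"]) auto
  qed
next
  have add: "x + y \<in> ?T" if xy: "x \<in> ?T" "y \<in> ?T" for x y
  proof -
    obtain u v where "\<forall>x\<in>S. 0 \<le> u x" "x = (\<Sum>x\<in>S. u x *\<^sub>R x)"
      "\<forall>x\<in>S. 0 \<le> v x" "y = (\<Sum>x\<in>S. v x *\<^sub>R x)"
      using xy by blast
    then show ?thesis
      by (intro CollectI exI[of _ "\<lambda>x. u x + v x"]) (auto simp: sum.distrib scaleR_add_left)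
  qed
  have scale: "a *\<^sub>R x \<in> ?T" if ax: "x \<in> ?T" "0 \<le> a" for x a
  proof -
    obtain u where "\<forall>x\<in>S. 0 \<le> u x" "x = (\<Sum>x\<in>S. u x *\<^sub>R x)"
      using ax(1) by blast
    then show ?thesis using ax(2)
      by (intro CollectI exI[of _ "\<lambda>x. a * u x"]) (auto simp: scaleR_sum_right)
  qed
  have "0 \<in> ?T"
    by (intro CollectI exI[of _ "\<lambda>_. 0"]) simp
  with add scale show "convex_cone ?T"
    unfolding convex_cone_iff by blast
next
  fix T' assume T': "S \<subseteq> T'" "convex_cone T'"
  show "?T \<subseteq> T'"
  proof clarify
    fix u :: "'a \<Rightarrow> real" assume u: "\<forall>x\<in>S. 0 \<le> u x"
    have "finite F \<Longrightarrow> F \<subseteq> S \<Longrightarrow> (\<Sum>x\<in>F. u x *\<^sub>R x) \<in> T'" for F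
      by (induction F rule: finite_induct)
        (use T' u in \<open>auto intro!: convex_cone_contains_0 convex_cone_add convex_cone_scaleR\<close>)
    then show "(\<Sum>x\<in>S. u x *\<^sub>R x) \<in> T'"
      using assms by blast
  qed
qed

lemma convex_hull_insert_0_finite:
  fixes S :: "'a::real_vector set"
  assumes "finite S" "0 \<notin> S"
  shows "convex hull (insert 0 S) =
    {\<Sum>x\<in>S. u x *\<^sub>R x | u. (\<forall>x\<in>S. 0 \<le> u x) \<and> sum u S \<le> 1}" (is "_ = ?T")
proof (intro equalityI subsetI)
  fix y assume "y \<in> convex hull (insert 0 S)"
  then obtain u where u: "\<forall>x\<in>insert 0 S. 0 \<le> u x" "sum u (insert 0 S) = 1"
    "(\<Sum>x\<in>insert 0 S. u x *\<^sub>R x) = y"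
    using assms(1) by (subst (asm) convex_hull_finite) auto
  then show "y \<in> ?T"
    using assms by (intro CollectI exI[of _ u]) auto
next
  fix y assume "y \<in> ?T"
  then obtain u where u: "\<forall>x\<in>S. 0 \<le> u x" "sum u S \<le> 1" "y = (\<Sum>x\<in>S. u x *\<^sub>R x)"
    by blast
  \<comment> \<open>the origin takes the weight that is left over\<close>
  define v where "v = u(0 := 1 - sum u S)"
  have "sum v S = sum u S" "(\<Sum>x\<in>S. v x *\<^sub>R x) = y"
    using assms(2) u(3) by (auto simp: v_def intro!: sum.cong)
  moreover have "v 0 = 1 - sum u S" "\<forall>x\<in>insert 0 S. 0 \<le> v x"
    using u by (auto simp: v_def)
  ultimately have "(\<forall>x\<in>insert 0 S. 0 \<le> v x) \<and> sum v (insert 0 S) = 1 \<and>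
      (\<Sum>x\<in>insert 0 S. v x *\<^sub>R x) = y"
    using assms by simp
  then show "y \<in> convex hull (insert 0 S)"
    using assms(1) by (subst convex_hull_finite) auto
qed

text \<open>When all generators have entry \<open>1\<close> at \<open>p\<close>, entry \<open>p\<close> of a conic combination is its total
  weight, so the bound \<open>x $ p \<le> 1\<close> alone cuts the cone down to the convex hull.\<close>

lemma convex_cone_hull_inter_unit_cbox:
  fixes R :: "(real ^ 'n) set"
  assumes fin: "finite R" and box: "R \<subseteq> cbox 0 1" and top: "\<And>r. r \<in> R \<Longrightarrow> r $ p = 1"
  shows "(convex_cone hull R) \<inter> cbox 0 1 = convex hull (insert 0 R)"
proof
  have "0 \<notin> R"
    using top by force
  show "(convex_cone hull R) \<inter> cbox 0 1 \<subseteq> convex hull (insert 0 R)"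
  proof
    fix x assume x: "x \<in> (convex_cone hull R) \<inter> cbox 0 1"
    then obtain u where u: "\<forall>r\<in>R. 0 \<le> u r" "x = (\<Sum>r\<in>R. u r *\<^sub>R r)"
      using convex_cone_hull_finite[OF fin] by auto
    have "sum u R = x $ p"
      using u(2) top by simp
    also have "\<dots> \<le> 1"
      using x by (simp add: mem_box_cart)
    finally show "x \<in> convex hull (insert 0 R)"
      using u convex_hull_insert_0_finite[OF fin \<open>0 \<notin> R\<close>] by blast
  qed
next
  have "insert 0 R \<subseteq> (convex_cone hull R) \<inter> cbox 0 1"
    using box by (auto simp: hull_inc convex_cone_hull_contains_0 mem_box_cart)
  then show "convex hull (insert 0 R) \<subseteq> (convex_cone hull R) \<inter> cbox 0 1"
    by (intro hull_minimal convex_Int convex_convex_cone_hull convex_box)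
qed

lemma convex_cone_hull_nonneg:
  fixes R :: "(real ^ 'n) set"
  assumes "R \<subseteq> {x. \<forall>e. 0 \<le> x $ e}"
  shows "convex_cone hull R \<subseteq> {x. \<forall>e. 0 \<le> x $ e}"
  by (rule hull_minimal) (use assms in \<open>auto simp: convex_cone_iff\<close>)

section \<open>Blocking families as covering problems\<close>

lemma inner_le_alpha:
  assumes "compact P" "z \<in> P"
  shows "c \<bullet> z \<le> alpha P c"
proof -
  obtain y where "c \<bullet> y = alpha P c" "\<forall>x\<in>P. c \<bullet> x \<le> c \<bullet> y"
    using alpha_attained[OF assms(1)] assms(2) by blast
  with assms(2) show ?thesis by force
qed

text \<open>A convex combination of the generators and the origin is dominated by the best generator of
  positive weight, provided its value is positive: otherwise the origin could be the best vertex.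
  Since no entry is negative, nothing cancels and the support of that generator does not exceed
  the support of the combination.\<close>

lemma dominating_generator:
  fixes R :: "(real ^ 'n) set"
  assumes fin: "finite R" and nonneg: "R \<subseteq> {x. \<forall>e. 0 \<le> x $ e}" and "0 \<notin> R"
    and z: "z \<in> convex hull (insert 0 R)" and pos: "0 < c \<bullet> z"
  obtains r where "r \<in> R" "supp r \<subseteq> supp z" "c \<bullet> z \<le> c \<bullet> r"
proof -
  obtain u where u: "\<forall>r\<in>R. 0 \<le> u r" "sum u R \<le> 1" "z = (\<Sum>r\<in>R. u r *\<^sub>R r)"
    using z convex_hull_insert_0_finite[OF fin \<open>0 \<notin> R\<close>] by auto
  have val: "c \<bullet> z = (\<Sum>r\<in>R. u r * (c \<bullet> r))"
    by (simp add: u(3) inner_sum_right)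
  have "\<exists>r\<in>R. 0 < u r \<and> c \<bullet> z \<le> c \<bullet> r"
  proof (rule ccontr)
    assume "\<not> ?thesis"
    then have less: "r \<in> R \<Longrightarrow> 0 < u r \<Longrightarrow> c \<bullet> r < c \<bullet> z" for r
      by force
    have le: "u r * (c \<bullet> r) \<le> u r * (c \<bullet> z)" if "r \<in> R" for r
      using less[OF that] u(1) that by (cases "u r = 0") (force intro: mult_left_mono)+
    have "\<exists>r\<in>R. 0 < u r"
    proof (rule ccontr)
      assume "\<not> ?thesis"
      then have "\<forall>r\<in>R. u r = 0"
        using u(1) by force
      with val pos show False by simp
    qed
    then obtain r where r: "r \<in> R" "0 < u r" by blast
    have "(\<Sum>r\<in>R. u r * (c \<bullet> r)) < (\<Sum>r\<in>R. u r * (c \<bullet> z))"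
      by (rule sum_strict_mono_ex1[OF fin]) (use le less[OF r] r in \<open>auto intro!: bexI[of _ r] mult_strict_left_mono\<close>)
    then have "c \<bullet> z < (\<Sum>r\<in>R. u r * (c \<bullet> z))"
      using val by simp
    also have "\<dots> = sum u R * (c \<bullet> z)"
      by (simp add: sum_distrib_right)
    also have "\<dots> \<le> c \<bullet> z"
      using u(2) pos by (simp add: mult_left_le_one_le sum_nonneg u(1))
    finally show False by simp
  qed
  then obtain r where r: "r \<in> R" "0 < u r" "c \<bullet> z \<le> c \<bullet> r" by blast
  have "supp r \<subseteq> supp z"
  proof
    fix e assume "e \<in> supp r"
    then have "0 < u r * r $ e"
      using r(2) by (simp add: supp_def)
    also have "\<dots> \<le> (\<Sum>s\<in>R. u s * s $ e)"
      by (rule member_le_sum) (use r(1) u(1) nonneg fin in \<open>auto intro: mult_nonneg_nonneg\<close>)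
    finally show "e \<in> supp z"
      by (simp add: supp_def u(3))
  qed
  with r that show thesis by blast
qed

text \<open>A violating list of points can be traded for a set of generators: dropping repetitions only
  removes nonnegative losses, and in the other direction the missing points are maximisers of \<open>c\<close>,
  whose loss is zero.\<close>

lemma not_in_blocking_family_iff:
  fixes R :: "(real ^ 'n) set"
  defines "P \<equiv> convex hull (insert 0 R)"
  assumes fin: "finite R" and nonneg: "R \<subseteq> {x. \<forall>e. 0 \<le> x $ e}" and "0 \<notin> R"
    and pos: "0 < alpha P c"
  shows "J \<notin> blocking_family P c l \<longleftrightarrow>
    (\<exists>W\<subseteq>R. card W \<le> l \<and> J \<inter> (\<Inter>r\<in>W. supp r) = {} \<and> (\<Sum>r\<in>W. alpha P c - c \<bullet> r) < alpha P c)"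
    (is "_ \<longleftrightarrow> (\<exists>W\<subseteq>R. ?cover W)")
proof
  have cpt: "compact P"
    unfolding P_def using fin by (simp add: finite_imp_compact_convex_hull)
  note loss = inner_le_alpha[OF cpt, of _ c]
  have RP: "R \<subseteq> P"
    unfolding P_def by (auto intro: hull_inc)
  {
    assume "J \<notin> blocking_family P c l"
    then obtain z where z: "\<And>i. i \<in> {1..l} \<Longrightarrow> z i \<in> P" "(\<Inter>i\<in>{1..l}. supp (z i)) \<inter> J = {}"
      "alpha P c * (real l - 1) < (\<Sum>i=1..l. c \<bullet> z i)"
      unfolding blocking_family_def by force
    have total: "(\<Sum>i=1..l. alpha P c - c \<bullet> z i) < alpha P c"
      using z(3) by (simp add: sum_subtractf algebra_simps)
    have "\<exists>r. r \<in> R \<and> supp r \<subseteq> supp (z i) \<and> c \<bullet> z i \<le> c \<bullet> r" if i: "i \<in> {1..l}" for i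
    proof -
      have "alpha P c - c \<bullet> z i \<le> (\<Sum>i=1..l. alpha P c - c \<bullet> z i)"
        by (rule member_le_sum) (use i z(1) loss in auto)
      then have "0 < c \<bullet> z i"
        using total by linarith
      then show ?thesis
        using dominating_generator[OF fin nonneg \<open>0 \<notin> R\<close>] z(1)[OF i] unfolding P_def by metis
    qed
    then obtain v where v: "\<And>i. i \<in> {1..l} \<Longrightarrow> v i \<in> R \<and> supp (v i) \<subseteq> supp (z i) \<and> c \<bullet> z i \<le> c \<bullet> v i"
      by metis
    have sub: "v ` {1..l} \<subseteq> R"
      using v by auto
    have "(\<Sum>r\<in>v ` {1..l}. alpha P c - c \<bullet> r) \<le> (\<Sum>i=1..l. alpha P c - c \<bullet> v i)"
      by (rule sum_image_le[unfolded o_def]) (use v loss RP in auto)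
    also have "\<dots> \<le> (\<Sum>i=1..l. alpha P c - c \<bullet> z i)"
      by (intro sum_mono) (use v in auto)
    also note total
    finally have "(\<Sum>r\<in>v ` {1..l}. alpha P c - c \<bullet> r) < alpha P c" .
    moreover have "card (v ` {1..l}) \<le> l"
      using card_image_le[of "{1..l}" v] by simp
    moreover have "J \<inter> (\<Inter>r\<in>v ` {1..l}. supp r) = {}"
      using z(2) v by blast
    ultimately have "?cover (v ` {1..l})"
      by blast
    with sub show "\<exists>W\<subseteq>R. ?cover W"
      by blast
  next
    assume "\<exists>W\<subseteq>R. ?cover W"
    then obtain W where W: "W \<subseteq> R" "card W \<le> l" "J \<inter> (\<Inter>r\<in>W. supp r) = {}"
      "(\<Sum>r\<in>W. alpha P c - c \<bullet> r) < alpha P c"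
      by blast
    have "finite W"
      using W(1) fin finite_subset by blast
    then obtain h where h: "bij_betw h {1..card W} W"
      using bij_betw_from_nat_into_finite ex_bij_betw_nat_finite_1 by blast
    have "P \<noteq> {}"
      unfolding P_def by simp
    then obtain y where y: "y \<in> P" "c \<bullet> y = alpha P c"
      using alpha_attained[OF cpt] by blast
    define z where "z i = (if i \<le> card W then h i else y)" for i
    have zP: "\<forall>i\<in>{1..l}. z i \<in> P"
    proof
      fix i assume "i \<in> {1..l}"
      then have "i \<le> card W \<Longrightarrow> h i \<in> W"
        using bij_betwE[OF h] by simp
      then show "z i \<in> P"
        using y(1) W(1) RP by (auto simp: z_def)
    qed
    have cover: "(\<Inter>i\<in>{1..l}. supp (z i)) \<inter> J = {}"
    proof -
      have "W \<subseteq> z ` {1..l}"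
      proof
        fix r assume "r \<in> W"
        then obtain i where "i \<in> {1..card W}" "r = h i"
          using bij_betw_imp_surj_on[OF h] by blast
        then show "r \<in> z ` {1..l}"
          using W(2) by (intro image_eqI[of _ _ i]) (auto simp: z_def)
      qed
      then show ?thesis
        using W(3) by blast
    qed
    have "(\<Sum>i=1..l. alpha P c - c \<bullet> z i) = (\<Sum>i=1..card W. alpha P c - c \<bullet> z i)"
      by (rule sum.mono_neutral_right) (use W(2) y(2) in \<open>auto simp: z_def\<close>)
    also have "\<dots> = (\<Sum>i=1..card W. alpha P c - c \<bullet> h i)"
      by (intro sum.cong) (auto simp: z_def)
    also have "\<dots> = (\<Sum>r\<in>W. alpha P c - c \<bullet> r)"
      by (rule sum.reindex_bij_betw[OF h])
    also note W(4)
    finally have "\<not> (\<Sum>i=1..l. c \<bullet> z i) \<le> alpha P c * (real l - 1)"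
      by (simp add: sum_subtractf algebra_simps)
    with zP cover show "J \<notin> blocking_family P c l"
      unfolding blocking_family_def by blast
  }
qed

text \<open>Thinning a cover to a subcover only discards nonnegative losses, so a bound on the size
  of subcovers bounds the level at which every failure is visible.\<close>

lemma blocking_family_stabilizes:
  fixes R :: "(real ^ 'n) set"
  defines "P \<equiv> convex hull (insert 0 R)"
  assumes fin: "finite R" and nonneg: "R \<subseteq> {x. \<forall>e. 0 \<le> x $ e}" and "0 \<notin> R"
    and pos: "0 < alpha P c" and "1 \<le> q"
    and subcover: "\<And>W J. W \<subseteq> R \<Longrightarrow> J \<inter> (\<Inter>r\<in>W. supp r) = {} \<Longrightarrow>
      \<exists>W'\<subseteq>W. card W' \<le> q \<and> J \<inter> (\<Inter>r\<in>W'. supp r) = {}"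
  shows "blocking_family P c q = blocking_family_inf P c"
proof
  note iff = not_in_blocking_family_iff[OF fin nonneg \<open>0 \<notin> R\<close>, of c, folded P_def, OF pos]
  have cpt: "compact P"
    unfolding P_def using fin by (simp add: finite_imp_compact_convex_hull)
  show "blocking_family_inf P c \<subseteq> blocking_family P c q"
    using \<open>1 \<le> q\<close> by (auto simp: blocking_family_inf_def)
  have "J \<notin> blocking_family P c q" if notin: "J \<notin> blocking_family P c l" for J l
  proof -
    obtain W where W: "W \<subseteq> R" "J \<inter> (\<Inter>r\<in>W. supp r) = {}"
      "(\<Sum>r\<in>W. alpha P c - c \<bullet> r) < alpha P c"
      using notin unfolding iff by blast
    obtain W' where W': "W' \<subseteq> W" "card W' \<le> q" "J \<inter> (\<Inter>r\<in>W'. supp r) = {}"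
      using subcover[OF W(1,2)] by blast
    have "(\<Sum>r\<in>W'. alpha P c - c \<bullet> r) \<le> (\<Sum>r\<in>W. alpha P c - c \<bullet> r)"
    proof (rule sum_mono2)
      show "finite W"
        using W(1) fin finite_subset by blast
      fix r assume "r \<in> W - W'"
      then have "r \<in> P"
        using W(1) unfolding P_def by (auto intro: hull_inc)
      then show "0 \<le> alpha P c - c \<bullet> r"
        using inner_le_alpha[OF cpt] by simp
    qed (fact W'(1))
    with W(3) have "(\<Sum>r\<in>W'. alpha P c - c \<bullet> r) < alpha P c"
      by linarith
    with W(1) W' show ?thesis
      unfolding iff by blast
  qed
  then show "blocking_family P c q \<subseteq> blocking_family_inf P c"
    by (auto simp: blocking_family_inf_def)
qed

section \<open>The generators\<close>

text \<open>The entry \<open>1/2\<close> leaves the support full, as the entry \<open>1\<close> would, but unlike \<open>1\<close> it keeps the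
  rays distinct and linearly independent.\<close>

definition ray :: "'n set \<Rightarrow> 'n \<Rightarrow> real ^ 'n" where
  "ray A e = (\<chi> i. if i = e then if e \<in> A then 0 else 1 / 2 else 1)"

lemma supp_ray: "supp (ray A e) = (if e \<in> A then - {e} else UNIV)"
  by (auto simp: supp_def ray_def)

lemma inj_ray: "inj (ray A)"
proof (rule injI)
  fix e f assume "ray A e = ray A f"
  then have "ray A e $ e = ray A f $ e"
    by simp
  then show "e = f"
    by (auto simp: ray_def split: if_splits)
qed

text \<open>In a vanishing combination the coordinate \<open>p\<close> says that the weights add up to zero, and then
  coordinate \<open>e\<close>, where only \<open>ray A e\<close> deviates from \<open>1\<close>, isolates the weight of \<open>ray A e\<close>.\<close>

lemma independent_rays: "independent (ray A ` (- {p}))"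
proof -
  have "u (ray A e) = 0"
    if comb: "(\<Sum>r\<in>ray A ` (- {p}). u r *\<^sub>R r) = 0" and e: "e \<noteq> p" for u e
  proof -
    have "(\<Sum>f\<in>- {p}. u (ray A f) *\<^sub>R ray A f) = 0"
      using comb by (simp add: sum.reindex[OF inj_on_subset[OF inj_ray subset_UNIV]])
    from arg_cong[OF this, of "\<lambda>x. x $ i" for i]
    have coord: "(\<Sum>f\<in>- {p}. u (ray A f) * ray A f $ i) = 0" for i
      by simp
    have "(\<Sum>f\<in>- {p}. u (ray A f) * ray A f $ p) = (\<Sum>f\<in>- {p}. u (ray A f))"
      by (intro sum.cong) (auto simp: ray_def)
    then have "0 = (\<Sum>f\<in>- {p}. u (ray A f)) - (\<Sum>f\<in>- {p}. u (ray A f) * ray A f $ e)"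
      using coord by simp
    also have "\<dots> = (\<Sum>f\<in>- {p}. if f = e then u (ray A e) * (1 - ray A e $ e) else 0)"
      unfolding sum_subtractf[symmetric]
      by (intro sum.cong) (auto simp: ray_def)
    also have "\<dots> = u (ray A e) * (1 - ray A e $ e)"
      using e by simp
    finally show ?thesis
      by (auto simp: ray_def split: if_splits)
  qed
  then show ?thesis
    by (subst independent_explicit) auto
qed

text \<open>The complements of the supports are singletons or empty, so there is no choice
  in how to cover \<open>J\<close>.\<close>

lemma rays_cover_iff:
  assumes "W \<subseteq> range (ray A)"
  shows "J \<inter> (\<Inter>r\<in>W. supp r) = {} \<longleftrightarrow> J \<subseteq> A \<and> ray A ` J \<subseteq> W"
proof
  assume empty: "J \<inter> (\<Inter>r\<in>W. supp r) = {}"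
  have "j \<in> A \<and> ray A j \<in> W" if j: "j \<in> J" for j
  proof -
    obtain r where r: "r \<in> W" "j \<notin> supp r"
      using empty j by blast
    then obtain e where e: "r = ray A e"
      using assms by blast
    then have "j \<in> A \<and> e = j"
      using r(2) by (auto simp: supp_ray split: if_splits)
    with e r(1) show ?thesis by simp
  qed
  then show "J \<subseteq> A \<and> ray A ` J \<subseteq> W" by blast
next
  assume "J \<subseteq> A \<and> ray A ` J \<subseteq> W"
  moreover have "j \<notin> supp (ray A j)" if "j \<in> A" for j
    using that by (simp add: supp_ray)
  ultimately show "J \<inter> (\<Inter>r\<in>W. supp r) = {}" by blast
qed

lemma stabilization_depth_rays:
  fixes A :: "'n::finite set"
  assumes "p \<notin> A" "A \<noteq> {}"
  shows "stabilization_depth (convex hull (insert 0 (ray A ` (- {p})))) = enat (card A)"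
proof -
  define R where "R = ray A ` (- {p})"
  define P where "P = convex hull (insert 0 R)"
  have fin: "finite R" and range: "R \<subseteq> range (ray A)"
    by (auto simp: R_def)
  have nonneg: "R \<subseteq> {x. \<forall>e. 0 \<le> x $ e}"
    by (auto simp: R_def ray_def)
  have top: "r $ p = 1" if "r \<in> R" for r
    using that by (auto simp: R_def ray_def split: if_splits)
  then have "0 \<notin> R" by force
  have AR: "ray A ` A \<subseteq> R"
    using assms(1) by (auto simp: R_def)
  have cardA: "1 \<le> card A"
    using assms(2) by (simp add: Suc_le_eq card_gt_0_iff)
  note iff = not_in_blocking_family_iff[OF fin nonneg \<open>0 \<notin> R\<close>, folded P_def]

  have upper: "blocking_family P c (card A) = blocking_family_inf P c" if "0 < alpha P c" for c
    unfolding P_def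
  proof (rule blocking_family_stabilizes[OF fin nonneg \<open>0 \<notin> R\<close> _ cardA])
    fix W J assume "W \<subseteq> R" "J \<inter> (\<Inter>r\<in>W. supp r) = {}"
    then have J: "J \<subseteq> A" "ray A ` J \<subseteq> W"
      using rays_cover_iff[of W A J] range by auto
    have "card (ray A ` J) \<le> card A"
      using J(1) card_image_le[of J "ray A"] card_mono[of A J] by simp
    moreover have "J \<inter> (\<Inter>r\<in>ray A ` J. supp r) = {}"
      using J(1) rays_cover_iff[of "ray A ` J" A J] by auto
    ultimately show "\<exists>W'\<subseteq>W. card W' \<le> card A \<and> J \<inter> (\<Inter>r\<in>W'. supp r) = {}"
      using J(2) by blast
  qed (use that in \<open>simp_all add: P_def\<close>)

  have lower: "card A \<le> k"
    if k: "1 \<le> k" "\<forall>c. 0 < alpha P c \<longrightarrow> blocking_family P c k = blocking_family_inf P c" for k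
  proof -
    \<comment> \<open>all rays are optimal for this objective, so every cover of \<open>A\<close> has total loss \<open>0\<close>\<close>
    define c :: "real ^ 'n" where "c = axis p 1"
    have val: "c \<bullet> r = 1" if "r \<in> R" for r
      using top[OF that] by (simp add: c_def inner_axis')
    obtain a where a: "a \<in> A"
      using assms(2) by blast
    have ra: "ray A a \<in> R"
      using AR a by blast
    have alpha: "alpha P c = 1"
    proof -
      have "R \<subseteq> {x. c \<bullet> x \<le> 1}"
        using val by auto
      then have "P \<subseteq> {x. c \<bullet> x \<le> 1}"
        unfolding P_def by (intro hull_minimal convex_halfspace_le) auto
      moreover have "ray A a \<in> P"
        using ra by (auto simp: P_def intro: hull_inc)
      ultimately show ?thesis
        unfolding alpha_def using val[OF ra] by (intro cSup_eq_maximum) (auto intro: rev_image_eqI)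
    qed
    then have pos: "0 < alpha P c" by simp
    have "(\<Sum>r\<in>ray A ` A. alpha P c - c \<bullet> r) = 0"
      using AR val alpha by (intro sum.neutral) auto
    with pos have "(\<Sum>r\<in>ray A ` A. alpha P c - c \<bullet> r) < alpha P c"
      by linarith
    moreover have "A \<inter> (\<Inter>r\<in>ray A ` A. supp r) = {}"
      using rays_cover_iff[of "ray A ` A" A A] by auto
    moreover have "card (ray A ` A) \<le> card A"
      by (simp add: card_image_le)
    ultimately have "A \<notin> blocking_family P c (card A)"
      unfolding iff[OF pos] using AR by blast
    then have "A \<notin> blocking_family P c k"
      using k(2) cardA pos by (auto simp: blocking_family_inf_def)
    then obtain W where W: "W \<subseteq> R" "card W \<le> k" "A \<inter> (\<Inter>r\<in>W. supp r) = {}"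
      unfolding iff[OF pos] by blast
    have "ray A ` A \<subseteq> W"
      using W(1,3) rays_cover_iff[of W A A] range by auto
    then have "card (ray A ` A) \<le> card W"
      using W(1) fin by (meson card_mono finite_subset)
    then show ?thesis
      using W(2) by (simp add: card_image[OF inj_on_subset[OF inj_ray subset_UNIV]])
  qed

  have "stabilization_depth P = enat (card A)"
    unfolding stabilization_depth_def
  proof (rule antisym)
    show "Inf {enat q |q. 1 \<le> q \<and> (\<forall>c. 0 < alpha P c \<longrightarrow>
        blocking_family P c q = blocking_family_inf P c)} \<le> enat (card A)"
      by (rule Inf_lower) (use upper cardA in auto)
    show "enat (card A) \<le> Inf {enat q |q. 1 \<le> q \<and> (\<forall>c. 0 < alpha P c \<longrightarrow>
        blocking_family P c q = blocking_family_inf P c)}"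
      by (rule Inf_greatest) (use lower in auto)
  qed
  then show ?thesis
    by (simp add: P_def R_def)
qed

theorem proposition3p5:
  fixes m q :: nat
  assumes "1 \<le> q" and "q \<le> m" and "CARD('n::finite) = m + 1"
  shows "\<exists>K :: (real ^ 'n) set.
           rational_simplicial_cone K \<and>
           K \<subseteq> {x. \<forall>e. 0 \<le> x $ e} \<and>
           simplex_at_origin m (K \<inter> cbox 0 1) \<and>
           stabilization_depth (K \<inter> cbox 0 1) = enat q"
proof -
  obtain p :: 'n where True by simp
  have card: "card (- {p}) = m"
    using assms(3) by (simp add: Compl_eq_Diff_UNIV)
  then obtain A where A: "A \<subseteq> - {p}" "card A = q"
    using obtain_subset_with_card_n[of q "- {p}"] assms(2) by auto
  then have pA: "p \<notin> A" "A \<noteq> {}"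
    using assms(1) by auto
  define R where "R = ray A ` (- {p})"
  have fin: "finite R" and indep: "independent R"
    by (simp_all add: R_def independent_rays)
  have nonneg: "R \<subseteq> {x. \<forall>e. 0 \<le> x $ e}"
    by (auto simp: R_def ray_def)
  have cut: "(convex_cone hull R) \<inter> cbox 0 1 = convex hull (insert 0 R)"
    by (rule convex_cone_hull_inter_unit_cbox[where p = p])
      (auto simp: R_def ray_def mem_box_cart split: if_splits)
  have "card R = m"
    unfolding R_def using card by (simp add: card_image[OF inj_on_subset[OF inj_ray subset_UNIV]])
  with fin indep have "simplex_at_origin m (convex hull (insert 0 R))"
    unfolding simplex_at_origin_def by blast
  moreover have "\<forall>r\<in>R. \<forall>e. r $ e \<in> \<rat>"
    by (auto simp: R_def ray_def)
  with fin indep have "rational_simplicial_cone (convex_cone hull R)"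
    unfolding rational_simplicial_cone_def by blast
  moreover have "convex_cone hull R \<subseteq> {x. \<forall>e. 0 \<le> x $ e}"
    using nonneg by (rule convex_cone_hull_nonneg)
  moreover have "stabilization_depth (convex hull (insert 0 R)) = enat q"
    using stabilization_depth_rays[OF pA] A(2) by (simp add: R_def)
  ultimately show ?thesis
    using cut by (intro exI[of _ "convex_cone hull R"]) simp
qed

end
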